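(* Let $m,n\ge 2$ and let $\mathcal{T}=(t_{i_1\dots i_m})$ be an $m$th order $n$-dimensional real lower triangular tensor. Then for each $i\in\{1,\dots,n\}$ the diagonal entry $t_{ii\dots i}$ is an eigenvalue of $\mathcal{T}$.
   Context: An $m$th order $n$-dimensional real cubic tensor $\mathcal{T}=(t_{i_1\dots i_m})$ has entries $t_{i_1\dots i_m}\in\mathbb{R}$ for $i_1,\dots,i_m=1,\dots,n$. It is called a lower triangular tensor if $t_{i_1\dots i_m}=0$ whenever there is $j\in\{2,\dots,m\}$ with $i_j>i_1$. A number $\lambda\in\mathbb{C}$ is an eigenvalue of $\mathcal{T}$ if there exists a nonzero vector $x=(x_1,\dots,x_n)^\top\in\mathbb{C}^n$ with $\mathcal{T}x^{m-1}=\lambda x^{[m-1]}$, i.e. $\sum_{i_2,\dots,i_m=1}^n t_{k i_2\dots i_m}x_{i_2}\cdots x_{i_m}=\lambda x_k^{m-1}$ for all $k=1,\dots,n$. *)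

theory Defs
  imports Complex_Main "Jordan_Normal_Form.Matrix"
begin

text \<open>
  A real tensor of order \<open>m\<close> and dimension \<open>n\<close> is a function \<open>T :: nat list \<Rightarrow> real\<close> whose
  entry at \<open>(i\<^sub>1, \<dots>, i\<^sub>m)\<close> is \<open>T [i\<^sub>1, \<dots>, i\<^sub>m]\<close>; only its values on \<open>multi_indices m n\<close>
  matter. As in Jordan_Normal_Form, indices run over \<open>0, \<dots>, n - 1\<close>
  instead of \<open>1, \<dots>, n\<close>, and list positions over \<open>0, \<dots>, m - 1\<close>.
\<close>

definition multi_indices :: "nat \<Rightarrow> nat \<Rightarrow> nat list set" where
  "multi_indices m n = {js. set js \<subseteq> {..<n} \<and> length js = m}"

definition lower_triangular_tensor :: "nat \<Rightarrow> nat \<Rightarrow> (nat list \<Rightarrow> real) \<Rightarrow> bool" where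
  "lower_triangular_tensor m n T \<longleftrightarrow>
     (\<forall>js \<in> multi_indices m n. (\<exists>j \<in> {1..<m}. js ! j > js ! 0) \<longrightarrow> T js = 0)"

text \<open>The vector of left-hand sides \<open>T x\<^sup>m\<^sup>-\<^sup>1\<close>.\<close>

definition tensor_apply :: "nat \<Rightarrow> nat \<Rightarrow> (nat list \<Rightarrow> real) \<Rightarrow> complex vec \<Rightarrow> complex vec" where
  "tensor_apply m n T x =
     vec n (\<lambda>k. \<Sum>js \<in> multi_indices (m - 1) n.
                  complex_of_real (T (k # js)) * prod_list (map (\<lambda>i. x $ i) js))"

text \<open>The entrywise power \<open>x\<^bsup>[p]\<^esup>\<close>.\<close>

definition vec_power :: "complex vec \<Rightarrow> nat \<Rightarrow> complex vec" where
  "vec_power x p = map_vec (\<lambda>a. a ^ p) x"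

definition tensor_eigenvalue :: "nat \<Rightarrow> nat \<Rightarrow> (nat list \<Rightarrow> real) \<Rightarrow> complex \<Rightarrow> bool" where
  "tensor_eigenvalue m n T ev \<longleftrightarrow>
     (\<exists>x \<in> carrier_vec n. x \<noteq> 0\<^sub>v n \<and> tensor_apply m n T x = ev \<cdot>\<^sub>v vec_power x (m - 1))"

end

theory Submission
  imports Defs "HOL-Computational_Algebra.Fundamental_Theorem_Algebra"
begin

text \<open>
  Let \<open>\<lambda>\<close> be a diagonal entry and take the largest index \<open>l\<close> at which \<open>\<lambda>\<close> occurs on the
  diagonal. Put \<open>x\<^sub>j = 0\<close> for \<open>j < l\<close> and \<open>x\<^sub>l = 1\<close>; by triangularity the eigenvalue equations
  up to row \<open>l\<close> hold. Row \<open>k > l\<close> only involves \<open>x\<^sub>0, \<dots>, x\<^sub>k\<close>, and as a polynomial in \<open>x\<^sub>k\<close> it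
  has degree \<open>m - 1 \<ge> 1\<close>, because its leading coefficient is the difference between the \<open>k\<close>-th
  diagonal entry and \<open>\<lambda>\<close>, which is nonzero. Hence the rows can be solved one after the other.
\<close>

lemma finite_multi_indices [simp]: "finite (multi_indices p n)"
  unfolding multi_indices_def by (rule finite_lists_length_eq) simp

lemma lower_triangular_tensor_row_eq_0:
  assumes "lower_triangular_tensor (Suc p) n T" "k < n"
    and "js \<in> multi_indices p n" "j \<in> set js" "k < j"
  shows "T (k # js) = 0"
proof -
  have len: "length js = p"
    using assms(3) by (simp add: multi_indices_def)
  have "k # js \<in> multi_indices (Suc p) n"
    using assms(2,3) by (auto simp: multi_indices_def)
  moreover obtain r where "r < p" "js ! r = j"
    using assms(4) len by (auto simp: in_set_conv_nth)
  then have "\<exists>r \<in> {1..<Suc p}. (k # js) ! r > (k # js) ! 0"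
    using assms(5) by (intro bexI[of _ "Suc r"]) auto
  ultimately show ?thesis
    using assms(1) unfolding lower_triangular_tensor_def by blast
qed

lemma prod_list_of_bool_eq:
  "prod_list (map (\<lambda>i. of_bool (i = l)) js) = (of_bool (js = replicate (length js) l) :: 'a::semiring_1)"
  by (induction js) auto

lemma prod_list_linear_polys:
  fixes a b :: "'b \<Rightarrow> 'a::comm_semiring_1"
  shows "degree (\<Prod>i\<leftarrow>js. [:a i, b i:]) \<le> length js"
    and "coeff (\<Prod>i\<leftarrow>js. [:a i, b i:]) (length js) = (\<Prod>i\<leftarrow>js. b i)"
proof -
  \<comment> \<open>Both claims go through one induction: the new top coefficient also contains
    \<open>a i\<close> times the coefficient of \<open>?r\<close> at \<open>Suc (length js)\<close>,
    which vanishes by the degree bound.\<close>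
  have "degree (\<Prod>i\<leftarrow>js. [:a i, b i:]) \<le> length js \<and>
        coeff (\<Prod>i\<leftarrow>js. [:a i, b i:]) (length js) = (\<Prod>i\<leftarrow>js. b i)"
  proof (induction js)
    case (Cons i js)
    let ?r = "\<Prod>i\<leftarrow>js. [:a i, b i:]"
    have "degree ([:a i, b i:] * ?r) \<le> degree [:a i, b i:] + degree ?r"
      by (rule degree_mult_le)
    also have "\<dots> \<le> Suc (length js)"
      using Cons by simp
    finally show ?case
      using Cons by (auto simp: coeff_eq_0)
  qed simp
  then show "degree (\<Prod>i\<leftarrow>js. [:a i, b i:]) \<le> length js"
    and "coeff (\<Prod>i\<leftarrow>js. [:a i, b i:]) (length js) = (\<Prod>i\<leftarrow>js. b i)"
    by auto
qed

lemma poly_prod_list: "poly (prod_list ps) z = (\<Prod>p\<leftarrow>ps. poly p z)"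
  by (induction ps) auto

text \<open>Here \<open>p\<close> is the order minus one, so it is the degree of the row as a form.
  The vector is a plain function so that single entries can be changed by
  \<open>f(k := z)\<close>.\<close>

definition tensor_row :: "nat \<Rightarrow> nat \<Rightarrow> (nat list \<Rightarrow> real) \<Rightarrow> (nat \<Rightarrow> complex) \<Rightarrow> nat \<Rightarrow> complex" where
  "tensor_row p n T f k =
     (\<Sum>js \<in> multi_indices p n. complex_of_real (T (k # js)) * (\<Prod>i\<leftarrow>js. f i))"

text \<open>At a unit vector only the pure power of the \<open>l\<close>-th variable survives. This
  gives both the rows at the starting vector and, with \<open>l = k\<close>, the leading coefficient
  of row \<open>k\<close> in its own variable.\<close>

lemma tensor_row_unit:
  assumes "l < n"
  shows "tensor_row p n T (\<lambda>i. of_bool (i = l)) k = complex_of_real (T (k # replicate p l))"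
proof -
  have "tensor_row p n T (\<lambda>i. of_bool (i = l)) k =
      (\<Sum>js \<in> multi_indices p n. if js = replicate p l then complex_of_real (T (k # js)) else 0)"
    unfolding tensor_row_def
    by (intro sum.cong) (auto simp: prod_list_of_bool_eq multi_indices_def)
  moreover have "replicate p l \<in> multi_indices p n"
    using assms by (auto simp: multi_indices_def)
  ultimately show ?thesis
    by (simp add: sum.delta')
qed

text \<open>A monomial involving an index above \<open>k\<close> has coefficient zero in row
  \<open>k\<close>. Hence entries chosen later cannot spoil rows that are already solved.\<close>

lemma tensor_row_cong:
  assumes "lower_triangular_tensor (Suc p) n T" "k < n" "\<And>i. i \<le> k \<Longrightarrow> f i = g i"
  shows "tensor_row p n T f k = tensor_row p n T g k"
  unfolding tensor_row_def
proof (intro sum.cong refl)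
  fix js
  assume js: "js \<in> multi_indices p n"
  show "complex_of_real (T (k # js)) * (\<Prod>i\<leftarrow>js. f i) = complex_of_real (T (k # js)) * (\<Prod>i\<leftarrow>js. g i)"
  proof (cases "\<exists>j \<in> set js. k < j")
    case True
    then show ?thesis
      using lower_triangular_tensor_row_eq_0[OF assms(1,2) js] by auto
  next
    case False
    then have "map f js = map g js"
      using assms(3) by auto
    then show ?thesis
      by (simp only:)
  qed
qed

lemma tensor_row_solvable:
  assumes "k < n" "p > 0" "complex_of_real (T (replicate (Suc p) k)) \<noteq> ev"
  shows "\<exists>z. tensor_row p n T (f(k := z)) k = ev * z ^ p"
proof -
  \<comment> \<open>Entry \<open>i\<close> of \<open>f(k := z)\<close> is
    \<open>a i + b i * z\<close>, so replacing each variable by \<open>[:a i, b i:]\<close> turns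
    the row into a polynomial in the unknown entry \<open>z\<close>.\<close>
  define a where "a = f(k := 0)"
  define b where "b = (\<lambda>i. of_bool (i = k) :: complex)"
  define q where "q = (\<Sum>js \<in> multi_indices p n.
      smult (complex_of_real (T (k # js))) (\<Prod>i\<leftarrow>js. [:a i, b i:])) - monom ev p"
  have "poly [:a i, b i:] z = (f(k := z)) i" for i z
    by (simp add: a_def b_def)
  then have eval: "poly q z = tensor_row p n T (f(k := z)) k - ev * z ^ p" for z
    by (simp add: q_def tensor_row_def poly_sum poly_prod_list poly_monom o_def del: fun_upd_apply)
  have "coeff q p = (\<Sum>js \<in> multi_indices p n.
      complex_of_real (T (k # js)) * coeff (\<Prod>i\<leftarrow>js. [:a i, b i:]) p) - ev"
    by (simp add: q_def coeff_sum)
  \<comment> \<open>The coefficient of \<open>z ^ p\<close> in each monomial is the product of the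
    slopes \<open>b i\<close>, so these coefficients add up to the row at the \<open>k\<close>-th
    unit vector.\<close>
  also have "\<dots> = tensor_row p n T b k - ev"
    unfolding tensor_row_def
    by (intro arg_cong2[where f = minus] sum.cong refl)
      (auto simp: multi_indices_def prod_list_linear_polys(2))
  also have "\<dots> \<noteq> 0"
    using assms(3) tensor_row_unit[OF assms(1)] by (simp add: b_def)
  finally have "degree q \<noteq> 0"
    using assms(2) le_degree by fastforce
  then obtain z where "poly q z = 0"
    using fundamental_theorem_of_algebra[of q] by (auto simp: constant_degree)
  then show ?thesis
    using eval by auto
qed

lemma tensor_rows_solvable:
  assumes tri: "lower_triangular_tensor (Suc p) n T" and "p > 0" and "l < n"
    and ev: "ev = complex_of_real (T (replicate (Suc p) l))"
    and last: "\<And>k. l < k \<Longrightarrow> k < n \<Longrightarrow> complex_of_real (T (replicate (Suc p) k)) \<noteq> ev"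
  shows "\<exists>f. f l = 1 \<and> (\<forall>k < n. tensor_row p n T f k = ev * f k ^ p)"
proof -
  \<comment> \<open>Rows below \<open>N\<close> are solved. The induction starts at
    \<open>Suc l\<close>, so each step alters only an entry beyond \<open>l\<close> and keeps
    \<open>f l = 1\<close>, which later makes the eigenvector nonzero.\<close>
  have "N \<le> n \<Longrightarrow> \<exists>f. f l = 1 \<and> (\<forall>k < N. tensor_row p n T f k = ev * f k ^ p)" if "Suc l \<le> N" for N
    using that
  proof (induction N rule: dec_induct)
    case base
    \<comment> \<open>For \<open>k < l\<close> both sides vanish: the left by triangularity, as
      \<open>p > 0\<close> makes \<open>l\<close> occur in \<open>replicate p l\<close>, and the
      right because \<open>0 ^ p = 0\<close> for \<open>p > 0\<close>.\<close>
    have "complex_of_real (T (k # replicate p l)) = ev * of_bool (k = l) ^ p" if "k < Suc l" for k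
    proof (cases "k = l")
      case False
      have "replicate p l \<in> multi_indices p n" "l \<in> set (replicate p l)"
        using \<open>p > 0\<close> \<open>l < n\<close> by (auto simp: multi_indices_def)
      then have "T (k # replicate p l) = 0"
        using lower_triangular_tensor_row_eq_0[OF tri] False that \<open>l < n\<close> by force
      then show ?thesis
        using False \<open>p > 0\<close> by simp
    qed (simp add: ev)
    then show ?case
      using tensor_row_unit[OF \<open>l < n\<close>, of p T] by (intro exI[of _ "\<lambda>i. of_bool (i = l)"]) simp
  next
    case (step N)
    then obtain f where f: "f l = 1" "\<And>k. k < N \<Longrightarrow> tensor_row p n T f k = ev * f k ^ p"
      by force
    obtain z where z: "tensor_row p n T (f(N := z)) N = ev * z ^ p"
      using tensor_row_solvable[of N n p T ev f] last[of N] step \<open>p > 0\<close> by auto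
    have "tensor_row p n T (f(N := z)) k = tensor_row p n T f k" if "k < N" for k
      using that step by (intro tensor_row_cong[OF tri]) auto
    then have "tensor_row p n T (f(N := z)) k = ev * (f(N := z)) k ^ p" if "k < Suc N" for k
      using that f(2) z by (cases "k = N") auto
    moreover have "(f(N := z)) l = 1"
      using f(1) step.hyps by simp
    ultimately show ?case
      by blast
  qed
  then show ?thesis
    using \<open>l < n\<close> by auto
qed

theorem proposition2p1:
  fixes m n :: nat and T :: "nat list \<Rightarrow> real"
  assumes "m \<ge> 2" and "n \<ge> 2"
    and "lower_triangular_tensor m n T"
  shows "\<forall>i < n. tensor_eigenvalue m n T (complex_of_real (T (replicate m i)))"
proof (intro allI impI)
  fix i
  assume "i < n"
  obtain p where m: "m = Suc p" and "p > 0"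
    using assms(1) by (cases m) auto
  let ?ev = "complex_of_real (T (replicate m i))"
  let ?L = "{l. l < n \<and> T (replicate m l) = T (replicate m i)}"
  have "finite ?L" "?L \<noteq> {}"
    using \<open>i < n\<close> by auto
  define l where "l = Max ?L"
  have "l \<in> ?L"
    unfolding l_def by (rule Max_in) fact+
  then have l: "l < n" "T (replicate m l) = T (replicate m i)"
    by auto
  have "complex_of_real (T (replicate (Suc p) k)) \<noteq> ?ev" if "l < k" "k < n" for k
  proof -
    have "k \<notin> ?L"
      using Max_ge[OF \<open>finite ?L\<close>, of k] that(1) unfolding l_def by linarith
    then show ?thesis
      using that(2) by (simp add: m del: replicate_Suc)
  qed
  then obtain f where f: "f l = 1" "\<And>k. k < n \<Longrightarrow> tensor_row p n T f k = ?ev * f k ^ p"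
    using tensor_rows_solvable[of p n T l ?ev] assms(3) \<open>p > 0\<close> l m by auto
  have "vec n f \<noteq> 0\<^sub>v n"
    using f(1) l(1) by (metis index_vec index_zero_vec(1) zero_neq_one)
  moreover have "tensor_apply m n T (vec n f) = ?ev \<cdot>\<^sub>v vec_power (vec n f) (m - 1)"
  proof (rule eq_vecI)
    fix k
    assume "k < dim_vec (?ev \<cdot>\<^sub>v vec_power (vec n f) (m - 1))"
    then have "k < n"
      by (simp add: vec_power_def)
    \<comment> \<open>\<open>vec n f $ i\<close> is known to be \<open>f i\<close> only for
      \<open>i < n\<close>, which holds for all entries of a multi-index.\<close>
    have "(\<Prod>i\<leftarrow>js. vec n f $ i) = (\<Prod>i\<leftarrow>js. f i)" if "js \<in> multi_indices p n" for js
      using that by (intro arg_cong[where f = prod_list] map_cong) (auto simp: multi_indices_def)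
    then have "tensor_apply m n T (vec n f) $ k = tensor_row p n T f k"
      using \<open>k < n\<close> by (simp add: tensor_apply_def tensor_row_def m cong: sum.cong)
    then show "tensor_apply m n T (vec n f) $ k = (?ev \<cdot>\<^sub>v vec_power (vec n f) (m - 1)) $ k"
      using f(2) \<open>k < n\<close> by (simp add: vec_power_def m)
  qed (simp add: tensor_apply_def vec_power_def)
  ultimately show "tensor_eigenvalue m n T ?ev"
    unfolding tensor_eigenvalue_def by (intro bexI[of _ "vec n f"]) auto
qed

end
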